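(* If $k,N\ge 2$ are integers, then $$\lim_{q\to 1}F_{\mathcal{S}^{(k)}_{\mathrm{fr}}(N)}(q)=\prod_{p\le N,\ p\text{ prime}}\left(1-\frac{1}{p^k}\right),$$ where the limit is taken as $q$ tends to $1$ from within the unit disk.
   Context: $\mathcal{S}^{(k)}_{\mathrm{fr}}(N)=\{n\ge 1: p^k\nmid n\text{ for every prime }p\le N\}$. A partition is a finite non-increasing sequence of positive integers $\lambda=(\lambda_1,\dots,\lambda_{\ell(\lambda)})$; $\mathcal{P}$ is the set of all partitions, $\ell(\lambda)$ is the number of parts, $|\lambda|=\lambda_1+\cdots+\lambda_{\ell(\lambda)}$ is the size, and $\mathrm{sm}(\lambda)=\lambda_{\ell(\lambda)}$ is the smallest part (defined for nonempty $\lambda$). The partition-theoretic Möbius function is $\mu_{\mathcal{P}}(\lambda)=0$ if $\lambda$ has repeated parts and $\mu_{\mathcal{P}}(\lambda)=(-1)^{\ell(\lambda)}$ otherwise; put $\mu^*_{\mathcal{P}}(\lambda)=-\mu_{\mathcal{P}}(\lambda)$. For a set $\mathcal{S}$ of positive integers and $|q|<1$, define $$F_{\mathcal{S}}(q)=\sum_{\lambda\in\mathcal{P},\ \mathrm{sm}(\lambda)\in\mathcal{S}}\mu^*_{\mathcal{P}}(\lambda)q^{|\lambda|},$$ the sum running over nonempty partitions whose smallest part lies in $\mathcal{S}$.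
   Formalization: The limit q→1 is proved within some Stolz angle |1-q|<M(1-|q|), M>1 depending on k and N (so in particular radially), not over the whole unit disk, where it fails: for k=N=2, F diverges along q=exp(-t) with arg t constant between 63.7 and 90 degrees. *)

theory Defs
  imports "HOL-Analysis.Analysis" "HOL-Computational_Algebra.Primes"
begin

text \<open>Partitions are the finite non-increasing lists of positive integers; the number of parts of
  \<open>xs\<close> is \<open>length xs\<close>, its size is \<open>sum_list xs\<close>, and the smallest part of a nonempty \<open>xs\<close> is
  \<open>last xs\<close>.\<close>

definition partitions :: "nat list set" where
  "partitions = {xs. sorted_wrt (\<ge>) xs \<and> (\<forall>x\<in>set xs. 1 \<le> x)}"

definition mu_P :: "nat list \<Rightarrow> int" where
  "mu_P xs = (if distinct xs then (- 1) ^ length xs else 0)"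

definition mu_star_P :: "nat list \<Rightarrow> int" where
  "mu_star_P xs = - mu_P xs"

definition F :: "nat set \<Rightarrow> complex \<Rightarrow> complex" where
  "F S q = (\<Sum>\<^sub>\<infinity>xs\<in>{xs\<in>partitions. xs \<noteq> [] \<and> last xs \<in> S}.
              of_int (mu_star_P xs) * q ^ sum_list xs)"

definition S_fr :: "nat \<Rightarrow> nat \<Rightarrow> nat set" where
  "S_fr k N = {n. 1 \<le> n \<and> (\<forall>p. prime p \<and> p \<le> N \<longrightarrow> \<not> p ^ k dvd n)}"

text \<open>The Stolz angle of aperture \<open>M\<close> at \<open>1\<close>, a part of the open unit disk. For \<open>M > 1\<close> it contains
  the radius \<open>[0,1)\<close> and, near \<open>1\<close>, every sector around that radius of half-angle less than
  \<open>arccos (1 / M)\<close>; for \<open>M \<le> 1\<close> it is empty.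

  It is used because the series has no limit at \<open>1\<close> in the whole disk. Take \<open>k = N = 2\<close>. With
  \<open>(a; q) = (\<Prod>m\<ge>0. 1 - a q^m)\<close>, the series is \<open>1 - (1/4) (\<Sum>\<zeta>^4 = 1. (q; q) / (\<zeta> q; q))\<close>.
  The terms with \<open>\<zeta> = i\<close> and \<open>\<zeta> = -i\<close> are exponentially small or large as \<open>q = exp (- \<tau>)\<close> tends to \<open>1\<close>
  with \<open>arg \<tau>\<close> constant according to the sign of \<open>Re ((\<pi>^2/6 - Li2 \<zeta>) / \<tau>)\<close>, where
  \<open>\<pi>^2/6 - Li2 (i) = 3\<pi>^2/16 - i G\<close> with \<open>G = 0.9159...\<close> Catalan's constant. On rays with
  \<open>\<bar>arg \<tau>\<bar>\<close> between \<open>63.7\<close> and \<open>90\<close> degrees one of them is unbounded and the other tends to \<open>0\<close>.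
  The angle that is allowed depends on \<open>k\<close> and \<open>N\<close> and shrinks to \<open>0\<close> as they grow.\<close>

definition stolz :: "real \<Rightarrow> complex set" where
  "stolz M = {q. norm q < 1 \<and> norm (1 - q) < M * (1 - norm q)}"

end

theory Submission
  imports Defs
begin

text \<open>Only partitions into distinct parts contribute to \<open>F S q\<close>. Sorting them by their smallest part gives
  \<open>F S q = (\<Sum>n\<in>S. q^n (\<Prod>m>n. 1 - q^m))\<close>. By Euler's theorem
  \<open>(\<Prod>m>n. 1 - q^m) = 1 / ((q; q)_n H(q))\<close> with \<open>H(x) = (\<Sum>n\<ge>0. x^n / (q; q)_n)\<close>, so \<open>F S q\<close> is the part of the
  series \<open>H(q)\<close> that is indexed by \<open>S\<close>, divided by \<open>H(q)\<close> (\<open>F_sums\<close>, \<open>infsum_signed_weight_eq\<close>).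

  The set \<open>S\<close> is periodic modulo \<open>L = (\<Prod>p\<le>N. p^k)\<close>. Expanding its indicator function in the characters
  \<open>n \<mapsto> \<zeta>^n\<close> with \<open>\<zeta>^L = 1\<close> writes \<open>F S q\<close> as a fixed linear combination of the quotients
  \<open>H(\<zeta> q) / H(q)\<close> (\<open>F_eq_sum_characters\<close>). The quotient for \<open>\<zeta> = 1\<close> is \<open>1\<close>, and its coefficient is the density of
  \<open>S\<close>, which is the product in the theorem (\<open>card_multiples_avoiding\<close>).

  It remains to see that the other quotients tend to \<open>0\<close> (\<open>euler_series_ratio_tendsto_0\<close>). Since \<open>H\<close> satisfies
  \<open>H(q x) = (1 - x) H(x)\<close>, one finds \<open>H(x) = exp (\<Sum>j\<ge>1. x^j / (j (1 - q^j)))\<close>, hence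
  \<open>H(\<zeta> q) / H(q) = exp (G(q) / (1 - q))\<close> with \<open>G(q) = (\<Sum>j\<ge>1. (\<zeta>^j - 1) q^j (1 - q) / (j (1 - q^j)))\<close>. In any Stolz
  angle the terms are dominated by a constant times \<open>1 / j^2\<close>, so \<open>G(q)\<close> tends to
  \<open>C = (\<Sum>j\<ge>1. (\<zeta>^j - 1) / j^2)\<close>, and \<open>Re C < 0\<close>. When the Stolz angle is narrow enough, \<open>1 / (1 - q)\<close> is so close
  in direction to the positive reals that \<open>Re (G(q) / (1 - q))\<close> tends to \<open>-\<infinity>\<close>.\<close>

section \<open>Partitions sorted by smallest part\<close>

text \<open>The finite \<open>q\<close>-Pochhammer symbol \<open>(q; q)\<close> with \<open>n\<close> factors.\<close>
definition qpoch :: "complex \<Rightarrow> nat \<Rightarrow> complex" where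
  "qpoch q n = (\<Prod>i=1..n. 1 - q ^ i)"

definition strict_partitions_above :: "nat \<Rightarrow> nat list set" where
  "strict_partitions_above n = {xs. sorted_wrt (>) xs \<and> (\<forall>x\<in>set xs. n < x)}"

text \<open>On lists with distinct parts this is \<open>\<mu>\<close> times \<open>q\<close> to the size; partitions with a repeated part
  contribute nothing to the series, so only strictly decreasing lists matter.\<close>
definition signed_weight :: "complex \<Rightarrow> nat list \<Rightarrow> complex" where
  "signed_weight q xs = (- 1) ^ length xs * q ^ sum_list xs"

lemma one_minus_power_neq_0:
  fixes q :: complex
  assumes "norm q < 1" "0 < i"
  shows "1 - q ^ i \<noteq> 0"
proof
  assume "1 - q ^ i = 0"
  then have "norm q ^ i = 1" by (simp flip: norm_power)
  with assms show False by (metis norm_ge_zero power_less_one_iff less_irrefl)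
qed

lemma qpoch_0 [simp]: "qpoch q 0 = 1"
  by (simp add: qpoch_def)

lemma qpoch_Suc: "qpoch q (Suc n) = qpoch q n * (1 - q ^ Suc n)"
  by (simp add: qpoch_def)

lemma qpoch_neq_0: "norm q < 1 \<Longrightarrow> qpoch q n \<noteq> 0"
  using one_minus_power_neq_0[of q] by (auto simp: qpoch_def)

lemma sorted_wrt_greater_iff:
  fixes xs :: "nat list"
  shows "sorted_wrt (>) xs \<longleftrightarrow> sorted_wrt (\<ge>) xs \<and> distinct xs"
  by (induction xs) (auto simp: le_less)

lemma strict_partition_eqI:
  assumes "xs \<in> strict_partitions_above n" "ys \<in> strict_partitions_above m" "set xs = set ys"
  shows "xs = ys"
proof -
  have "sorted_wrt (<) (rev xs)" "sorted_wrt (<) (rev ys)"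
    using assms(1,2) by (auto simp: strict_partitions_above_def sorted_wrt_rev)
  with assms(3) have "rev xs = rev ys"
    by (intro strict_sorted_equal) auto
  then show ?thesis by simp
qed

text \<open>A strictly decreasing list is determined by its set of parts. Hence, for parts taken from a finite
  set \<open>B\<close>, the sum of \<open>r ^ size\<close> is at most \<open>\<Prod>m\<in>B. 1 + r ^ m\<close>, which stays below
  \<open>exp (1 / (1 - r))\<close>, independently of \<open>B\<close>.\<close>
lemma abs_summable_signed_weight:
  assumes q: "norm q < 1"
  shows "(\<lambda>xs. norm (signed_weight q xs)) summable_on strict_partitions_above 0"
proof (rule nonneg_bdd_above_summable_on)
  define r where "r = norm q"
  have r: "0 \<le> r" "r < 1" using q by (auto simp: r_def)
  show "bdd_above (sum (\<lambda>xs. norm (signed_weight q xs)) ` {F. F \<subseteq> strict_partitions_above 0 \<and> finite F})"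
  proof (rule bdd_aboveI2[where M = "exp (1 / (1 - r))"])
    fix X assume "X \<in> {F. F \<subseteq> strict_partitions_above 0 \<and> finite F}"
    then have X: "X \<subseteq> strict_partitions_above 0" "finite X" by auto
    define B where "B = (\<Union>xs\<in>X. set xs)"
    have B: "finite B" using X by (auto simp: B_def)
    have inj: "inj_on set X"
      using X strict_partition_eqI by (meson inj_onI subsetD)
    have "(\<Sum>xs\<in>X. norm (signed_weight q xs)) = (\<Sum>xs\<in>X. \<Prod>m\<in>set xs. r ^ m)"
    proof (rule sum.cong[OF refl])
      fix xs assume "xs \<in> X"
      then have "distinct xs"
        using X by (auto simp: strict_partitions_above_def sorted_wrt_greater_iff)
      then have "(\<Prod>m\<in>set xs. r ^ m) = r ^ sum_list xs"
        by (simp add: power_sum distinct_sum_list_conv_Sum)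
      then show "norm (signed_weight q xs) = (\<Prod>m\<in>set xs. r ^ m)"
        by (simp add: signed_weight_def norm_mult norm_power r_def)
    qed
    also have "\<dots> = (\<Sum>A\<in>set ` X. \<Prod>m\<in>A. r ^ m)"
      by (simp add: sum.reindex[OF inj])
    also have "\<dots> \<le> (\<Sum>A\<in>Pow B. \<Prod>m\<in>A. r ^ m)"
      using B r by (intro sum_mono2) (auto simp: B_def prod_nonneg)
    also have "\<dots> = (\<Prod>m\<in>B. r ^ m + 1)"
      using prod_add[OF B, of "\<lambda>m. r ^ m" "\<lambda>_. 1"] by simp
    also have "\<dots> \<le> (\<Prod>m\<in>B. exp (r ^ m))"
      using r by (intro prod_mono) (auto simp: add.commute)
    also have "\<dots> = exp (\<Sum>m\<in>B. r ^ m)"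
      using B by (simp add: exp_sum)
    also have "(\<Sum>m\<in>B. r ^ m) \<le> (\<Sum>m. r ^ m)"
      using B r by (intro sum_le_suminf) (auto simp: summable_geometric)
    also have "\<dots> = 1 / (1 - r)"
      using r by (simp add: suminf_geometric)
    finally show "(\<Sum>xs\<in>X. norm (signed_weight q xs)) \<le> exp (1 / (1 - r))" by simp
  qed
qed auto

lemma summable_signed_weight:
  assumes "norm q < 1"
  shows "signed_weight q summable_on strict_partitions_above n"
proof (rule summable_on_subset)
  show "signed_weight q summable_on strict_partitions_above 0"
    using abs_summable_summable[OF abs_summable_signed_weight[OF assms]] .
qed (auto simp: strict_partitions_above_def)

lemma inj_on_snoc: "inj_on (\<lambda>xs. xs @ [a]) A"
  by (auto intro: inj_onI)

lemma signed_weight_snoc: "signed_weight q (xs @ [m]) = - (q ^ m) * signed_weight q xs"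
  by (simp add: signed_weight_def power_add)

lemma infsum_signed_weight_snoc:
  "infsum (\<lambda>xs. signed_weight q (xs @ [m])) A = - (q ^ m) * infsum (signed_weight q) A"
  by (simp add: signed_weight_snoc infsum_uminus infsum_cmult_right')

text \<open>This is the product \<open>\<Prod>m>n. 1 - q ^ m\<close> losing its first factor: such a partition either omits
  the part \<open>Suc n\<close> or has it as its last entry.\<close>
lemma infsum_signed_weight_Suc:
  assumes q: "norm q < 1"
  shows "infsum (signed_weight q) (strict_partitions_above n) =
    (1 - q ^ Suc n) * infsum (signed_weight q) (strict_partitions_above (Suc n))"
proof -
  let ?D = strict_partitions_above and ?h = "\<lambda>xs. xs @ [Suc n]"
  have "xs \<in> ?D (Suc n) \<union> ?h ` ?D (Suc n)" if xs: "xs \<in> ?D n" for xs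
  proof (cases "Suc n \<in> set xs")
    case False
    then show ?thesis using xs
      by (auto simp: strict_partitions_above_def) (metis Suc_lessI)
  next
    case True
    then have "xs \<noteq> []" by auto
    then obtain ys y where ys: "xs = ys @ [y]" by (metis rev_exhaust)
    with xs True have "y = Suc n" "ys \<in> ?D (Suc n)"
      by (auto simp: strict_partitions_above_def sorted_wrt_append)
    with ys show ?thesis by auto
  qed
  then have split: "?D n = ?D (Suc n) \<union> ?h ` ?D (Suc n)"
    by (auto simp: strict_partitions_above_def sorted_wrt_append dest: Suc_lessD)
  have disj: "?D (Suc n) \<inter> ?h ` ?D (Suc n) = {}"
    by (auto simp: strict_partitions_above_def)
  have sum2: "signed_weight q summable_on ?h ` ?D (Suc n)"
    by (rule summable_on_subset[OF summable_signed_weight[OF q, of n]]) (use split in blast)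
  have "infsum (signed_weight q) (?D n) =
      infsum (signed_weight q) (?D (Suc n)) + infsum (signed_weight q) (?h ` ?D (Suc n))"
    unfolding split by (rule infsum_Un_disjoint[OF summable_signed_weight[OF q] sum2 disj])
  also have "infsum (signed_weight q) (?h ` ?D (Suc n)) =
      - (q ^ Suc n) * infsum (signed_weight q) (?D (Suc n))"
    by (simp add: infsum_reindex[OF inj_on_snoc] o_def infsum_signed_weight_snoc del: power_Suc)
  finally show ?thesis by (simp add: algebra_simps)
qed

lemma infsum_signed_weight_above:
  assumes q: "norm q < 1"
  shows "infsum (signed_weight q) (strict_partitions_above n) =
    infsum (signed_weight q) (strict_partitions_above 0) / qpoch q n"
proof (induction n)
  case (Suc n)
  have "1 - q ^ Suc n \<noteq> 0" using one_minus_power_neq_0[OF q] by blast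
  then show ?case
    using Suc infsum_signed_weight_Suc[OF q, of n] qpoch_neq_0[OF q, of n]
    by (simp add: qpoch_Suc field_simps del: power_Suc)
qed simp

lemma F_eq_infsum_strict_partitions:
  "F S q = - infsum (signed_weight q) {xs \<in> strict_partitions_above 0. xs \<noteq> [] \<and> last xs \<in> S}"
  unfolding F_def infsum_uminus[symmetric]
  by (rule infsum_cong_neutral)
    (auto simp: strict_partitions_above_def partitions_def sorted_wrt_greater_iff mu_star_P_def
      mu_P_def signed_weight_def Suc_le_eq)

text \<open>Sorting the partitions by their smallest part \<open>n\<close> leaves, above \<open>n\<close>, an arbitrary strict partition
  into parts larger than \<open>n\<close>.\<close>
lemma F_sums:
  assumes q: "norm q < 1" and S: "0 \<notin> S"
  shows "(\<lambda>n. of_bool (n \<in> S) * q ^ n / qpoch q n *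
    infsum (signed_weight q) (strict_partitions_above 0)) sums F S q"
proof -
  let ?D = strict_partitions_above and ?w = "signed_weight q"
  let ?E = "{xs \<in> ?D 0. xs \<noteq> [] \<and> last xs \<in> S}" and ?h = "\<lambda>(n, xs). xs @ [n :: nat]"
  define T where "T n = infsum ?w (?D n)" for n
  have T: "T n = T 0 / qpoch q n" for n
    unfolding T_def by (rule infsum_signed_weight_above[OF q])
  have E: "?h ` Sigma S ?D = ?E"
  proof (intro equalityI subsetI)
    fix xs assume "xs \<in> ?E"
    then obtain ys y where ys: "xs = ys @ [y]" "y \<in> S" "xs \<in> ?D 0"
      by (metis (mono_tags, lifting) last_snoc mem_Collect_eq rev_exhaust)
    then have "ys \<in> ?D y" by (auto simp: strict_partitions_above_def sorted_wrt_append)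
    with ys show "xs \<in> ?h ` Sigma S ?D" by force
  next
    fix xs assume "xs \<in> ?h ` Sigma S ?D"
    then show "xs \<in> ?E"
      using S by (auto simp: strict_partitions_above_def sorted_wrt_append intro!: gr0I)
  qed
  have inj: "inj_on ?h (Sigma S ?D)" by (auto intro: inj_onI)
  have "?w summable_on ?E"
    by (rule summable_on_subset[OF summable_signed_weight[OF q, of 0]]) auto
  then have "(?w \<circ> ?h) summable_on Sigma S ?D"
    unfolding E[symmetric] summable_on_reindex[OF inj] .
  moreover have "((\<lambda>y. (?w \<circ> ?h) (n, y)) has_sum - (q ^ n) * T n) (?D n)" for n
    using has_sum_cmult_right[OF has_sum_infsum[OF summable_signed_weight[OF q, of n]], of "- (q ^ n)"]
    by (simp add: T_def signed_weight_snoc)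
  ultimately have "((\<lambda>n. - (q ^ n) * T n) has_sum infsum (?w \<circ> ?h) (Sigma S ?D)) S"
    by (blast intro: has_sum_SigmaD has_sum_infsum)
  also have "infsum (?w \<circ> ?h) (Sigma S ?D) = infsum ?w ?E"
    unfolding E[symmetric] infsum_reindex[OF inj] ..
  also have "infsum ?w ?E = - F S q"
    using F_eq_infsum_strict_partitions[of S q] by simp
  finally have "((\<lambda>n. q ^ n * T n) has_sum F S q) S"
    by (simp add: has_sum_uminus)
  also have "?this \<longleftrightarrow> ((\<lambda>n. of_bool (n \<in> S) * q ^ n / qpoch q n * T 0) has_sum F S q) UNIV"
    by (rule has_sum_cong_neutral) (simp_all, subst T, simp)
  finally have "((\<lambda>n. of_bool (n \<in> S) * q ^ n / qpoch q n * T 0) has_sum F S q) UNIV" .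
  then show ?thesis unfolding T_def by (rule has_sum_imp_sums)
qed

section \<open>Euler's series and its logarithm\<close>

lemma norm_mult_less_1:
  fixes a b :: "'a :: real_normed_algebra"
  assumes "norm a < 1" "norm b < 1"
  shows "norm (a * b) < 1"
proof -
  have "norm (a * b) \<le> norm a * norm b" by (rule norm_mult_ineq)
  also have "\<dots> \<le> 1 * norm b" using assms by (intro mult_right_mono) auto
  finally show ?thesis using assms by simp
qed

lemma qpower_tendsto_1:
  fixes q :: complex
  assumes "norm q < 1"
  shows "(\<lambda>n. 1 - q ^ Suc n) \<longlonglongrightarrow> 1"
  using tendsto_diff[OF tendsto_const LIMSEQ_Suc[OF LIMSEQ_power_zero[OF assms]], of 1] by simp

lemma divide_conv_inverse_mult:
  fixes a b :: "'a :: field"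
  shows "a / b = inverse b * a"
  by (simp add: divide_inverse mult.commute)

text \<open>With \<open>(x; q) = (\<Prod>m\<ge>0. 1 - x q^m)\<close>, Euler's theorem says that this series is \<open>1 / (x; q)\<close>. Its logarithm
  below takes the place of the infinite product.\<close>
definition euler_series :: "complex \<Rightarrow> complex \<Rightarrow> complex" where
  "euler_series q x = (\<Sum>n. x ^ n / qpoch q n)"

lemma summable_euler_series:
  assumes q: "norm q < 1" and x: "norm x < 1"
  shows "summable (\<lambda>n. x ^ n / qpoch q n)"
proof -
  obtain c where c: "norm x < c" "c < 1" using dense[OF x] by auto
  have "(\<lambda>n. norm x / norm (1 - q ^ Suc n)) \<longlonglongrightarrow> norm x / norm (1 :: complex)"
    by (intro tendsto_intros qpower_tendsto_1[OF q]) auto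
  then have "eventually (\<lambda>n. norm x / norm (1 - q ^ Suc n) < c) sequentially"
    using c by (intro order_tendstoD) auto
  then obtain n0 where n0: "\<And>n. n \<ge> n0 \<Longrightarrow> norm x / norm (1 - q ^ Suc n) < c"
    by (auto simp: eventually_sequentially)
  show ?thesis
  proof (rule summable_ratio_test[OF c(2)])
    fix n assume "n \<ge> n0"
    have "norm (x ^ Suc n / qpoch q (Suc n)) =
        norm x / norm (1 - q ^ Suc n) * norm (x ^ n / qpoch q n)"
      by (simp add: qpoch_Suc norm_mult norm_divide norm_power del: power_Suc) (simp add: field_simps)
    also have "\<dots> \<le> c * norm (x ^ n / qpoch q n)"
      using n0[OF \<open>n \<ge> n0\<close>] by (intro mult_right_mono) auto
    finally show "norm (x ^ Suc n / qpoch q (Suc n)) \<le> c * norm (x ^ n / qpoch q n)" .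
  qed
qed

lemma euler_series_0 [simp]: "euler_series q 0 = 1"
proof -
  have "(\<lambda>n. inverse (qpoch q n) * 0 ^ n) sums inverse (qpoch q 0)" by (rule powser_sums_zero)
  then show ?thesis
    by (simp add: euler_series_def sums_iff divide_conv_inverse_mult)
qed

lemma isCont_euler_series_0:
  assumes q: "norm q < 1"
  shows "isCont (euler_series q) 0"
proof -
  have "summable (\<lambda>n. inverse (qpoch q n) * (1 / 2) ^ n)"
    unfolding divide_conv_inverse_mult[symmetric] by (rule summable_euler_series[OF q]) simp
  then have "isCont (\<lambda>x. \<Sum>n. inverse (qpoch q n) * x ^ n) 0"
    by (rule isCont_powser) simp
  then show ?thesis
    unfolding euler_series_def[abs_def] divide_conv_inverse_mult .
qed

text \<open>The denominators satisfy \<open>(1 - q ^ Suc n) / qpoch q (Suc n) = 1 / qpoch q n\<close>, so subtracting the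
  series at \<open>q * x\<close> shifts the index by one.\<close>
lemma euler_series_functional:
  assumes q: "norm q < 1" and x: "norm x < 1"
  shows "euler_series q (q * x) = (1 - x) * euler_series q x"
proof -
  have qx: "norm (q * x) < 1"
    by (rule norm_mult_less_1[OF q x])
  have "(\<lambda>n. x ^ n / qpoch q n - (q * x) ^ n / qpoch q n) sums
      (euler_series q x - euler_series q (q * x))"
    unfolding euler_series_def
    by (intro sums_diff summable_sums summable_euler_series q x qx)
  then have "(\<lambda>n. x ^ Suc n / qpoch q (Suc n) - (q * x) ^ Suc n / qpoch q (Suc n)) sums
      (euler_series q x - euler_series q (q * x))"
    by (subst sums_Suc_iff) simp
  moreover have "x ^ Suc n / qpoch q (Suc n) - (q * x) ^ Suc n / qpoch q (Suc n) =
      x * (x ^ n / qpoch q n)" for n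
  proof -
    have "x ^ Suc n / qpoch q (Suc n) - (q * x) ^ Suc n / qpoch q (Suc n) =
        x ^ Suc n * (1 - q ^ Suc n) / (qpoch q n * (1 - q ^ Suc n))"
      by (simp only: power_mult_distrib qpoch_Suc) (simp add: diff_divide_distrib algebra_simps)
    then show ?thesis
      using one_minus_power_neq_0[OF q, of "Suc n"] by simp
  qed
  ultimately have "(\<lambda>n. x * (x ^ n / qpoch q n)) sums (euler_series q x - euler_series q (q * x))"
    by simp
  moreover have "(\<lambda>n. x * (x ^ n / qpoch q n)) sums (x * euler_series q x)"
    unfolding euler_series_def
    by (intro sums_mult summable_sums summable_euler_series q x)
  ultimately have "euler_series q x - euler_series q (q * x) = x * euler_series q x"
    by (rule sums_unique2)
  then show ?thesis by (simp add: algebra_simps)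
qed

text \<open>This is \<open>- (\<Sum>m\<ge>0. ln (1 - x q^m))\<close>, expanded by the logarithmic series and summed over \<open>m\<close> first.
  The term for \<open>j = 0\<close> is \<open>1 / 0 = 0\<close>.\<close>
definition qlog :: "complex \<Rightarrow> complex \<Rightarrow> complex" where
  "qlog q x = (\<Sum>j. x ^ j / (of_nat j * (1 - q ^ j)))"

lemma summable_qlog:
  fixes q x :: complex
  assumes q: "norm q < 1" and x: "norm x < 1"
  shows "summable (\<lambda>j. x ^ j / (of_nat j * (1 - q ^ j)))"
proof (rule summable_comparison_test'[where N = 1])
  show "summable (\<lambda>j. norm x ^ j / (1 - norm q))"
    using x by (intro summable_divide summable_geometric) auto
next
  fix j :: nat assume j: "1 \<le> j"
  have "norm q ^ j \<le> norm q ^ 1" by (rule power_decreasing) (use q j in auto)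
  then have "1 - norm q \<le> norm (1 - q ^ j)"
    using norm_triangle_ineq2[of 1 "q ^ j"] by (simp add: norm_power)
  also have "\<dots> \<le> real j * norm (1 - q ^ j)"
    using j by (simp add: mult_le_cancel_right1)
  finally show "norm (x ^ j / (of_nat j * (1 - q ^ j))) \<le> norm x ^ j / (1 - norm q)"
    using q j unfolding norm_divide norm_mult norm_power norm_of_nat by (intro divide_left_mono mult_pos_pos) auto
qed

lemma qlog_0 [simp]: "qlog q 0 = 0"
proof -
  have "(\<lambda>j. inverse (of_nat j * (1 - q ^ j)) * 0 ^ j) sums inverse (of_nat 0 * (1 - q ^ 0))"
    by (rule powser_sums_zero)
  then show ?thesis
    by (simp add: qlog_def sums_iff divide_conv_inverse_mult)
qed

lemma isCont_qlog_0:
  assumes q: "norm q < 1"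
  shows "isCont (qlog q) 0"
proof -
  have "summable (\<lambda>j. inverse (of_nat j * (1 - q ^ j)) * (1 / 2) ^ j)"
    unfolding divide_conv_inverse_mult[symmetric] by (rule summable_qlog[OF q]) simp
  then have "isCont (\<lambda>x. \<Sum>j. inverse (of_nat j * (1 - q ^ j)) * x ^ j) 0"
    by (rule isCont_powser) simp
  then show ?thesis
    unfolding qlog_def[abs_def] divide_conv_inverse_mult .
qed

lemma exp_qlog_functional:
  assumes q: "norm q < 1" and x: "norm x < 1"
  shows "exp (qlog q (q * x)) = (1 - x) * exp (qlog q x)"
proof -
  have qx: "norm (q * x) < 1"
    by (rule norm_mult_less_1[OF q x])
  have "(\<lambda>j. x ^ j / (of_nat j * (1 - q ^ j)) - (q * x) ^ j / (of_nat j * (1 - q ^ j))) sums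
      (qlog q x - qlog q (q * x))"
    unfolding qlog_def by (intro sums_diff summable_sums summable_qlog q x qx)
  moreover have "x ^ j / (of_nat j * (1 - q ^ j)) - (q * x) ^ j / (of_nat j * (1 - q ^ j)) =
      x ^ j / of_nat j" for j
  proof (cases "j = 0")
    case False
    have "x ^ j / (of_nat j * (1 - q ^ j)) - (q * x) ^ j / (of_nat j * (1 - q ^ j)) =
        x ^ j * (1 - q ^ j) / (of_nat j * (1 - q ^ j))"
      by (simp only: power_mult_distrib) (simp add: diff_divide_distrib algebra_simps)
    then show ?thesis
      using one_minus_power_neq_0[OF q, of j] False by simp
  qed simp
  ultimately have "(\<lambda>j. x ^ j / of_nat j) sums (qlog q x - qlog q (q * x))" by simp
  moreover have "(\<lambda>j. x ^ j / of_nat j) sums - ln (1 - x)"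
    using sums_minus[OF Ln_series'[of "- x"]] x by simp
  ultimately have "qlog q x - qlog q (q * x) = - ln (1 - x)"
    by (rule sums_unique2)
  then have "qlog q (q * x) = ln (1 - x) + qlog q x"
    by (simp add: algebra_simps)
  moreover have "1 - x \<noteq> 0" using x by auto
  ultimately show ?thesis by (simp add: exp_add)
qed

text \<open>Both sides satisfy the same equation relating their values at \<open>x\<close> and \<open>q * x\<close>, so their quotient
  is constant along \<open>q ^ n * x\<close>, which tends to \<open>0\<close>, where both sides are continuous and equal to \<open>1\<close>.\<close>
lemma euler_series_eq_exp_qlog:
  assumes q: "norm q < 1" and x: "norm x < 1"
  shows "euler_series q x = exp (qlog q x)"
proof -
  define R where "R y = euler_series q y * exp (- qlog q y)" for y
  have nx: "norm (q ^ n * x) < 1" for n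
    by (induction n) (use norm_mult_less_1[OF q] x in \<open>auto simp: mult.assoc\<close>)
  have step: "R (q * y) = R y" if y: "norm y < 1" for y
  proof -
    have "1 - y \<noteq> 0" using y by auto
    then show ?thesis
      unfolding R_def exp_minus exp_qlog_functional[OF q y] euler_series_functional[OF q y]
      by (simp add: field_simps)
  qed
  have const: "R (q ^ n * x) = R x" for n
    by (induction n) (simp_all add: step[OF nx] mult.assoc)
  have "isCont R 0"
    unfolding R_def[abs_def] by (intro continuous_intros isCont_euler_series_0 isCont_qlog_0 q)
  moreover have "(\<lambda>n. q ^ n * x) \<longlonglongrightarrow> 0"
    using tendsto_mult_left_zero[OF LIMSEQ_power_zero[OF q]] .
  ultimately have "(\<lambda>n. R (q ^ n * x)) \<longlonglongrightarrow> R 0"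
    by (rule isCont_tendsto_compose)
  then have "R x = R 0"
    unfolding const by (simp add: LIMSEQ_const_iff)
  then show ?thesis
    by (simp add: R_def exp_minus field_simps)
qed

lemma F_all:
  assumes q: "norm q < 1"
  shows "F {1..} q = 1 - infsum (signed_weight q) (strict_partitions_above 0)"
proof -
  let ?D = "strict_partitions_above 0" and ?w = "signed_weight q"
  have sum: "?w summable_on ?D - {[]}"
    by (rule summable_on_subset[OF summable_signed_weight[OF q, of 0]]) auto
  have "?D = {[]} \<union> (?D - {[]})" by (auto simp: strict_partitions_above_def)
  then have "infsum ?w ?D = infsum ?w ({[]} \<union> (?D - {[]}))" by simp
  also have "\<dots> = infsum ?w {[]} + infsum ?w (?D - {[]})"
    by (rule infsum_Un_disjoint) (use sum in auto)
  also have "?D - {[]} = {xs \<in> ?D. xs \<noteq> [] \<and> last xs \<in> {1..}}"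
    by (auto simp: strict_partitions_above_def Suc_le_eq)
  also have "infsum ?w \<dots> = - F {1..} q"
    using F_eq_infsum_strict_partitions[of "{1..}" q] by simp
  finally show ?thesis by (simp add: signed_weight_def[of q "[]"])
qed

text \<open>The sum \<open>T\<close> over all strict partitions is \<open>\<Prod>m\<ge>1. 1 - q ^ m\<close>, expanded. Sorting the nonempty strict
  partitions by smallest part gives
  \<open>1 - T = T * (\<Sum>n\<ge>1. q ^ n / qpoch q n)\<close>, which is a linear equation for \<open>T\<close>.\<close>
lemma infsum_signed_weight_eq:
  assumes q: "norm q < 1"
  shows "infsum (signed_weight q) (strict_partitions_above 0) = 1 / euler_series q q"
proof -
  define T where "T = infsum (signed_weight q) (strict_partitions_above 0)"
  have "(\<lambda>n. of_bool (n \<in> {1..}) * q ^ n / qpoch q n * T) sums F {1..} q"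
    unfolding T_def by (rule F_sums[OF q]) simp
  moreover have "(\<lambda>n. q ^ n / qpoch q n * T - (if n = 0 then T else 0)) sums (euler_series q q * T - T)"
    unfolding euler_series_def
    by (intro sums_diff sums_mult2 summable_sums summable_euler_series q sums_single)
  moreover have "(\<lambda>n. q ^ n / qpoch q n * T - (if n = 0 then T else 0)) =
      (\<lambda>n. of_bool (n \<in> {1..}) * q ^ n / qpoch q n * T)"
    by (auto simp: fun_eq_iff)
  ultimately have "euler_series q q * T - T = F {1..} q"
    by (metis sums_unique2)
  then have "euler_series q q * T = 1"
    unfolding F_all[OF q] T_def by simp
  then show ?thesis
    unfolding T_def by (metis nonzero_mult_div_cancel_left mult_zero_left zero_neq_one)
qed

section \<open>Rotated arguments near the point 1\<close>

text \<open>This is \<open>(1 - q) * ln ((q; q) / (\<zeta> q; q))\<close>. The factor \<open>1 - q\<close> compensates the growth of the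
  logarithm near \<open>q = 1\<close>, so that a finite limit remains.\<close>
definition rate :: "complex \<Rightarrow> complex \<Rightarrow> complex" where
  "rate \<zeta> q = (\<Sum>j. (\<zeta> ^ j - 1) * (q ^ j * (1 - q) / (of_nat j * (1 - q ^ j))))"

lemma euler_series_ratio:
  assumes q: "norm q < 1" and z: "norm \<zeta> = 1"
  shows "euler_series q (\<zeta> * q) / euler_series q q = exp (rate \<zeta> q / (1 - q))"
proof -
  have zq: "norm (\<zeta> * q) < 1" using q z by (simp add: norm_mult)
  have "(\<lambda>j. (1 - q) * ((\<zeta> * q) ^ j / (of_nat j * (1 - q ^ j)) - q ^ j / (of_nat j * (1 - q ^ j)))) sums
      ((1 - q) * (qlog q (\<zeta> * q) - qlog q q))"
    unfolding qlog_def by (intro sums_mult sums_diff summable_sums summable_qlog q zq)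
  moreover have "(1 - q) * ((\<zeta> * q) ^ j / (of_nat j * (1 - q ^ j)) - q ^ j / (of_nat j * (1 - q ^ j))) =
      (\<zeta> ^ j - 1) * (q ^ j * (1 - q) / (of_nat j * (1 - q ^ j)))" for j
    unfolding diff_divide_distrib[symmetric] power_mult_distrib times_divide_eq_right
    by (rule arg_cong2[where f = "(/)"]) (simp_all add: algebra_simps)
  ultimately have "rate \<zeta> q = (1 - q) * (qlog q (\<zeta> * q) - qlog q q)"
    unfolding rate_def by (simp add: sums_iff)
  moreover have "1 - q \<noteq> 0" using q by auto
  ultimately have "rate \<zeta> q / (1 - q) = qlog q (\<zeta> * q) - qlog q q" by simp
  then show ?thesis
    by (simp add: euler_series_eq_exp_qlog q zq exp_diff)
qed

text \<open>In the Stolz angle \<open>1 - q\<close> is controlled by \<open>1 - r\<close> with \<open>r = norm q\<close>, and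
  \<open>1 - r ^ j\<close> is \<open>1 - r\<close> times \<open>j\<close> powers of \<open>r\<close>, each of them at least \<open>r ^ j\<close>. The resulting
  bound is summable in \<open>j\<close> and independent of \<open>q\<close>.\<close>
lemma stolz_term_bound:
  assumes q: "q \<in> stolz M" and j: "0 < j"
  shows "norm (q ^ j * (1 - q) / (of_nat j * (1 - q ^ j))) \<le> M / real j ^ 2"
proof -
  define r where "r = norm q"
  have r: "0 \<le> r" "r < 1" and w: "norm (1 - q) < M * (1 - r)"
    using q by (auto simp: stolz_def r_def)
  have "0 < M * (1 - r)" using w by (meson norm_ge_zero le_less_trans)
  then have M: "0 < M" using r by (simp add: zero_less_mult_iff)
  have "real j * r ^ j = (\<Sum>i<j. r ^ j)" by simp
  also have "\<dots> \<le> (\<Sum>i<j. r ^ i)"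
    using r by (intro sum_mono power_decreasing) auto
  finally have "(1 - r) * (real j * r ^ j) \<le> (1 - r) * (\<Sum>i<j. r ^ i)"
    using r by (intro mult_left_mono) auto
  also have "\<dots> = 1 - r ^ j" by (simp add: one_diff_power_eq)
  also have "\<dots> \<le> norm (1 - q ^ j)"
    using norm_triangle_ineq2[of 1 "q ^ j"] by (simp add: norm_power r_def)
  finally have key: "(1 - r) * (real j * r ^ j) \<le> norm (1 - q ^ j)" .
  have "real j * (r ^ j * norm (1 - q)) \<le> real j * (r ^ j * (M * (1 - r)))"
    using r w by (intro mult_left_mono) auto
  also have "\<dots> = M * ((1 - r) * (real j * r ^ j))" by simp
  also have "\<dots> \<le> M * norm (1 - q ^ j)"
    using key M by (intro mult_left_mono) auto
  finally have *: "real j * (r ^ j * norm (1 - q)) \<le> M * norm (1 - q ^ j)" .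
  have "norm (1 - q ^ j) > 0"
    using one_minus_power_neq_0[of q j] q j by (auto simp: stolz_def)
  with * j show ?thesis
    by (simp add: norm_mult norm_divide norm_power r_def[symmetric] divide_simps power2_eq_square)
       (simp add: mult_ac)
qed

lemma term_tendsto:
  fixes j :: nat
  assumes j: "0 < j"
  shows "((\<lambda>q::complex. q ^ j * (1 - q) / (of_nat j * (1 - q ^ j))) \<longlongrightarrow> 1 / of_nat j ^ 2) (at 1 within A)"
proof -
  have "((\<lambda>q::complex. q ^ j / (of_nat j * (\<Sum>i<j. q ^ i))) \<longlongrightarrow>
      1 ^ j / (of_nat j * (\<Sum>i<j. 1 ^ i))) (at 1 within A)"
    using j by (intro tendsto_intros) auto
  then have "((\<lambda>q::complex. q ^ j / (of_nat j * (\<Sum>i<j. q ^ i))) \<longlongrightarrow> 1 / of_nat j ^ 2) (at 1 within A)"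
    by (simp add: power2_eq_square)
  moreover have "eventually (\<lambda>q::complex. q ^ j / (of_nat j * (\<Sum>i<j. q ^ i)) =
      q ^ j * (1 - q) / (of_nat j * (1 - q ^ j))) (at 1 within A)"
    by (auto simp: eventually_at_filter one_diff_power_eq)
  ultimately show ?thesis
    by (rule Lim_transform_eventually)
qed

lemma norm_power_minus_1_le_2:
  fixes \<zeta> :: complex
  assumes "norm \<zeta> = 1"
  shows "norm (\<zeta> ^ j - 1) \<le> 2"
  using norm_triangle_ineq4[of "\<zeta> ^ j" 1] assms by (simp add: norm_power)

text \<open>Tannery's theorem, with the majorant from the preceding bounds. The limit is
  \<open>Li2 \<zeta> - \<pi>^2/6\<close>.\<close>
lemma rate_tendsto:
  assumes z: "norm \<zeta> = 1"
  shows "(rate \<zeta> \<longlongrightarrow> (\<Sum>j. (\<zeta> ^ j - 1) / of_nat j ^ 2)) (at 1 within stolz M)"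
proof (cases "at 1 within stolz M = bot")
  case False
  let ?a = "\<lambda>j q. (\<zeta> ^ j - 1) * (q ^ j * (1 - q) / (of_nat j * (1 - q ^ j)))"
  have "((\<lambda>q. ?a j q) \<longlongrightarrow> (\<zeta> ^ j - 1) / of_nat j ^ 2) (at 1 within stolz M)" for j
  proof (cases "j = 0")
    case False
    then show ?thesis
      using tendsto_mult[OF tendsto_const term_tendsto, of j "\<zeta> ^ j - 1"] by simp
  qed simp
  moreover have "eventually (\<lambda>(j, q). norm (?a j q) \<le> 2 * (M / real j ^ 2)) (at_top \<times>\<^sub>F (at 1 within stolz M))"
  proof (rule eventually_mono[OF eventually_prodI])
    show "eventually (\<lambda>j::nat. 0 < j) at_top" by (rule eventually_gt_at_top)
    show "eventually (\<lambda>q. q \<in> stolz M) (at 1 within stolz M)"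
      by (auto simp: eventually_at_filter)
    fix jq :: "nat \<times> complex" assume jq: "0 < fst jq \<and> snd jq \<in> stolz M"
    obtain j q where [simp]: "jq = (j, q)" by fastforce
    have "norm (?a j q) \<le> 2 * (M / real j ^ 2)"
      unfolding norm_mult[of "\<zeta> ^ j - 1"] using jq by (intro mult_mono norm_power_minus_1_le_2 z stolz_term_bound) auto
    then show "case jq of (j, q) \<Rightarrow> norm (?a j q) \<le> 2 * (M / real j ^ 2)" by simp
  qed
  moreover have "summable (\<lambda>j. 2 * (M / real j ^ 2))"
    using summable_mult[OF inverse_power_summable[of 2, where ?'a = real], of "2 * M"]
    by (simp add: field_simps)
  ultimately show ?thesis
    unfolding rate_def[abs_def]
    by (rule tannerys_theorem[THEN conjunct2, THEN conjunct2, OF _ _ _ False])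
next
  case True
  then show ?thesis by (simp only: tendsto_bot)
qed

lemma summable_limit_rate:
  fixes \<zeta> :: complex
  assumes z: "norm \<zeta> = 1"
  shows "summable (\<lambda>j. (\<zeta> ^ j - 1) / of_nat j ^ 2)"
proof (rule summable_comparison_test'[where N = 0])
  show "summable (\<lambda>j. 2 * inverse (real j ^ 2))"
    by (intro summable_mult inverse_power_summable) simp
  fix j
  show "norm ((\<zeta> ^ j - 1) / of_nat j ^ 2) \<le> 2 * inverse (real j ^ 2)"
    using norm_power_minus_1_le_2[OF z, of j]
    by (simp add: norm_divide norm_power divide_inverse[of _ "real j ^ 2"] mult_right_mono)
qed

lemma Re_less_1:
  assumes "norm z = 1" "z \<noteq> 1"
  shows "Re z < 1"
proof (rule ccontr)
  assume "\<not> Re z < 1"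
  then have "Re z = 1" using complex_Re_le_cmod[of z] assms by simp
  moreover from this have "Im z = 0" using assms(1) cmod_power2[of z] by simp
  ultimately show False using assms(2) by (simp add: complex_eq_iff)
qed

text \<open>Every term has nonpositive real part since \<open>\<zeta> ^ j\<close> lies on the unit circle, and the term
  for \<open>j = 1\<close> is strictly negative.\<close>
lemma Re_limit_rate_neg:
  assumes z: "norm \<zeta> = 1" "\<zeta> \<noteq> 1"
  shows "Re (\<Sum>j. (\<zeta> ^ j - 1) / of_nat j ^ 2) < 0"
proof -
  have "(\<lambda>j. - Re ((\<zeta> ^ j - 1) / of_nat j ^ 2)) sums - Re (\<Sum>j. (\<zeta> ^ j - 1) / of_nat j ^ 2)"
    by (intro sums_minus sums_Re summable_sums summable_limit_rate z)
  moreover have "0 < (\<Sum>j. - Re ((\<zeta> ^ j - 1) / of_nat j ^ 2))"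
  proof (rule suminf_pos2)
    show "summable (\<lambda>j. - Re ((\<zeta> ^ j - 1) / of_nat j ^ 2))"
      by (intro summable_minus summable_Re summable_limit_rate z)
    show "0 \<le> - Re ((\<zeta> ^ j - 1) / of_nat j ^ 2)" for j
    proof -
      have "Re (\<zeta> ^ j) \<le> 1"
        using complex_Re_le_cmod[of "\<zeta> ^ j"] z by (simp add: norm_power)
      moreover have "Re ((\<zeta> ^ j - 1) / of_nat j ^ 2) = (Re (\<zeta> ^ j) - 1) / real j ^ 2"
        using Re_divide_of_real[of "\<zeta> ^ j - 1" "real j ^ 2"] by simp
      ultimately show ?thesis by (simp add: divide_nonpos_nonneg)
    qed
    show "0 < - Re ((\<zeta> ^ 1 - 1) / of_nat 1 ^ 2)"
      using Re_less_1[OF z] by simp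
  qed
  ultimately show ?thesis by (simp add: sums_iff)
qed

text \<open>As \<open>M\<close> decreases to \<open>1\<close> the Stolz angle narrows to the radius: the direction of \<open>1 / (1 - q)\<close>
  deviates from the positive real axis by an amount that tends to \<open>0\<close>.\<close>
lemma stolz_direction:
  assumes q: "q \<in> stolz M" and M: "M > 1"
  shows "norm (cnj (1 - q) / of_real (norm (1 - q)) - 1) \<le> sqrt (2 - 2 / M)"
proof -
  define w where "w = 1 - q"
  define u where "u = cnj w / of_real (norm w)"
  have w: "w \<noteq> 0" using q by (auto simp: w_def stolz_def)
  have "norm w < M * (1 - norm q)" using q by (simp add: stolz_def w_def)
  also have "\<dots> \<le> M * Re w"
    using M complex_Re_le_cmod[of q] by (simp add: w_def)
  finally have "1 / M \<le> Re w / norm w" using w M by (simp add: field_simps)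
  then have Re_u: "1 / M \<le> Re u" by (simp add: u_def)
  have "norm u = 1" using w by (simp add: u_def norm_divide)
  then have "norm (u - 1) ^ 2 = 2 - 2 * Re u"
    using cmod_power2[of u] cmod_power2[of "u - 1"] by (simp add: power2_eq_square algebra_simps)
  also have "\<dots> \<le> 2 - 2 / M" using Re_u by simp
  finally show ?thesis unfolding u_def w_def by (rule real_le_rsqrt)
qed

text \<open>The logarithm of the quotient is \<open>rate \<zeta> q / (1 - q)\<close>, whose numerator tends to some \<open>C\<close> with
  negative real part. Multiplication by \<open>1 / (1 - q)\<close> rotates \<open>C\<close> as well as stretching it; in a
  sufficiently narrow Stolz angle the rotation is too small to move \<open>C\<close> out of the left half-plane,
  so the real part of the logarithm tends to \<open>-\<infinity>\<close>. How narrow the angle must be depends on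
  \<open>\<zeta>\<close>, which is why the statement concerns all \<open>M\<close> close enough to \<open>1\<close>.\<close>
lemma euler_series_ratio_tendsto_0:
  assumes z: "norm \<zeta> = 1" "\<zeta> \<noteq> 1"
  shows "eventually (\<lambda>M. ((\<lambda>q. euler_series q (\<zeta> * q) / euler_series q q) \<longlongrightarrow> 0) (at 1 within stolz M))
    (at_right 1)"
proof -
  define C where "C = (\<Sum>j. (\<zeta> ^ j - 1) / of_nat j ^ 2)"
  define c where "c = - Re C"
  have c: "c > 0" using Re_limit_rate_neg[OF z] by (simp add: c_def C_def)
  \<comment> \<open>At \<open>M = 1\<close> the deviation bound is \<open>0\<close>, so nearby it costs at most half of the margin \<open>c\<close>.
    The deviation of \<open>rate \<zeta> q\<close> from \<open>C\<close> will cost a further quarter.\<close>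
  have "((\<lambda>M::real. norm C * sqrt (2 - 2 / M)) \<longlongrightarrow> norm C * sqrt (2 - 2 / 1)) (at_right 1)"
    by (intro tendsto_intros) auto
  then have "eventually (\<lambda>M. norm C * sqrt (2 - 2 / M) < c / 2) (at_right 1)"
    using c by (intro order_tendstoD) auto
  moreover have "eventually (\<lambda>M::real. M > 1) (at_right 1)"
    by (rule eventually_at_right_less)
  ultimately show ?thesis
  proof eventually_elim
    case (elim M)
    let ?F = "at 1 within stolz M"
    have "eventually (\<lambda>q. dist (rate \<zeta> q) C < c / 4) ?F"
      using rate_tendsto[OF z(1), of M] c unfolding C_def by (intro tendstoD) auto
    moreover have "eventually (\<lambda>q. q \<in> stolz M) ?F"
      by (auto simp: eventually_at_filter)
    ultimately have "eventually (\<lambda>q. norm (euler_series q (\<zeta> * q) / euler_series q q) \<le>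
        exp (- (c / 4 * inverse (norm (1 - q))))) ?F"
    proof eventually_elim
      case (elim q)
      define w where "w = 1 - q"
      define u where "u = cnj w / of_real (norm w)"
      have q: "norm q < 1" using elim by (simp add: stolz_def)
      then have w: "w \<noteq> 0" by (auto simp: w_def)
      then have norm_u: "norm u = 1" by (simp add: u_def norm_divide)
      have inv: "rate \<zeta> q / w = rate \<zeta> q * u / of_real (norm w)"
        using w by (simp add: u_def field_simps complex_norm_square[symmetric] power2_eq_square)
      have "norm C * norm (u - 1) \<le> norm C * sqrt (2 - 2 / M)"
        using stolz_direction[OF \<open>q \<in> stolz M\<close> \<open>M > 1\<close>]
        by (intro mult_left_mono) (auto simp: u_def w_def)
      then have 1: "Re (C * (u - 1)) \<le> c / 2"
        using complex_Re_le_cmod[of "C * (u - 1)"] \<open>norm C * sqrt (2 - 2 / M) < c / 2\<close>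
        by (simp add: norm_mult)
      have 2: "Re ((rate \<zeta> q - C) * u) \<le> c / 4"
        using complex_Re_le_cmod[of "(rate \<zeta> q - C) * u"] elim norm_u
        by (simp add: norm_mult dist_norm)
      have "rate \<zeta> q * u = C + C * (u - 1) + (rate \<zeta> q - C) * u"
        by (simp add: algebra_simps)
      then have "Re (rate \<zeta> q * u) = - c + Re (C * (u - 1)) + Re ((rate \<zeta> q - C) * u)"
        by (simp only: plus_complex.simps c_def minus_minus)
      then have "Re (rate \<zeta> q * u) \<le> - (c / 4)" using 1 2 by linarith
      then have "Re (rate \<zeta> q / w) \<le> - (c / 4) / norm w"
        unfolding inv Re_divide_of_real by (rule divide_right_mono) simp
      also have "\<dots> = - (c / 4 * inverse (norm w))"
        by (simp only: divide_inverse mult_minus_left)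
      finally have "Re (rate \<zeta> q / w) \<le> - (c / 4 * inverse (norm w))" .
      then show ?case
        unfolding euler_series_ratio[OF q z(1)] norm_exp_eq_Re exp_le_cancel_iff w_def .
    qed
    moreover have "((\<lambda>q. exp (- (c / 4 * inverse (norm (1 - q))))) \<longlongrightarrow> 0) ?F"
    proof (rule filterlim_compose[OF exp_at_bot])
      have "filterlim (\<lambda>q. norm (1 - q :: complex)) (at_right 0) ?F"
        unfolding filterlim_at by (auto simp: eventually_at_filter intro!: tendsto_eq_intros)
      then have "filterlim (\<lambda>q. (c / 4) * inverse (norm (1 - q :: complex))) at_top ?F"
        using c by (intro filterlim_tendsto_pos_mult_at_top[OF tendsto_const]
          filterlim_compose[OF filterlim_inverse_at_top_right]) auto
      then show "filterlim (\<lambda>q. - (c / 4 * inverse (norm (1 - q :: complex)))) at_bot ?F"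
        by (rule filterlim_compose[OF filterlim_uminus_at_bot_at_top])
    qed
    ultimately show ?case
      by (rule Lim_null_comparison)
  qed
qed

section \<open>Periodic sets of smallest parts\<close>

definition root_of_unity :: "nat \<Rightarrow> nat \<Rightarrow> complex" where
  "root_of_unity L j = exp (2 * of_real pi * \<i> * (of_nat j / of_nat L))"

lemma root_of_unity_eq_iff:
  "0 < L \<Longrightarrow> root_of_unity L j = root_of_unity L k \<longleftrightarrow> j mod L = k mod L"
  unfolding root_of_unity_def using complex_root_unity_eq[of L j k] by simp

lemma root_of_unity_0 [simp]: "root_of_unity L 0 = 1"
  by (simp add: root_of_unity_def)

lemma root_of_unity_neq_0 [simp]: "root_of_unity L j \<noteq> 0"
  by (simp add: root_of_unity_def)

lemma norm_root_of_unity [simp]: "norm (root_of_unity L j) = 1"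
  by (simp add: root_of_unity_def norm_exp_eq_Re)

lemma root_of_unity_power: "root_of_unity L j ^ n = root_of_unity L (j * n)"
  by (simp add: root_of_unity_def exp_of_nat_mult[symmetric] mult_ac)

lemma sum_root_of_unity_quotient:
  assumes L: "0 < L"
  shows "(\<Sum>j<L. (root_of_unity L n / root_of_unity L m) ^ j) =
    (if n mod L = m mod L then of_nat L else 0)"
proof -
  let ?z = "root_of_unity L n / root_of_unity L m"
  have "root_of_unity L (n * L) = 1" for n
    using root_of_unity_eq_iff[OF L, of "n * L" 0] by (simp add:)
  then have "?z ^ L = 1"
    by (simp add: power_divide root_of_unity_power)
  moreover have "?z = 1 \<longleftrightarrow> n mod L = m mod L"
    using root_of_unity_eq_iff[OF L] by simp
  ultimately show ?thesis
    by (auto simp: sum_gp_strict)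
qed

text \<open>The discrete Fourier transform on the integers modulo \<open>L\<close>.\<close>
lemma periodic_eq_sum_characters:
  fixes f :: "nat \<Rightarrow> complex"
  assumes L: "0 < L" and f: "\<And>n. f (n mod L) = f n"
  shows "f n = (\<Sum>j<L. ((\<Sum>m<L. f m / root_of_unity L m ^ j) / of_nat L) * root_of_unity L j ^ n)"
proof -
  have "(\<Sum>j<L. ((\<Sum>m<L. f m / root_of_unity L m ^ j) / of_nat L) * root_of_unity L j ^ n) =
      (\<Sum>j<L. \<Sum>m<L. f m / of_nat L * (root_of_unity L n / root_of_unity L m) ^ j)"
    unfolding sum_divide_distrib sum_distrib_right
    by (intro sum.cong refl) (simp add: root_of_unity_power power_divide mult.commute)
  also have "\<dots> = (\<Sum>m<L. f m / of_nat L * (\<Sum>j<L. (root_of_unity L n / root_of_unity L m) ^ j))"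
    by (subst sum.swap) (simp add: sum_distrib_left)
  also have "\<dots> = (\<Sum>m<L. if m = n mod L then f m else 0)"
    using L by (intro sum.cong) (auto simp: sum_root_of_unity_quotient)
  also have "\<dots> = f n" using L f by simp
  finally show ?thesis ..
qed

text \<open>Twisting the coefficients of \<open>euler_series\<close> by \<open>\<zeta> ^ n\<close> amounts to evaluating it at \<open>\<zeta> * q\<close>,
  so a Fourier expansion of the indicator function of \<open>S\<close> becomes an expansion of \<open>F S\<close>.\<close>
lemma F_eq_sum_characters:
  assumes q: "norm q < 1" and S: "0 \<notin> S"
    and c: "\<And>n. of_bool (n \<in> S) = (\<Sum>j<L. c j * root_of_unity L j ^ n)"
  shows "F S q = (\<Sum>j<L. c j * (euler_series q (root_of_unity L j * q) / euler_series q q))"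
proof -
  have "(\<lambda>n. \<Sum>j<L. c j * ((root_of_unity L j * q) ^ n / qpoch q n * (1 / euler_series q q))) sums
      (\<Sum>j<L. c j * (euler_series q (root_of_unity L j * q) * (1 / euler_series q q)))"
    unfolding euler_series_def
    by (intro sums_sum sums_mult sums_mult2 summable_sums summable_euler_series q)
      (simp add: norm_mult q)
  moreover have "(\<Sum>j<L. c j * ((root_of_unity L j * q) ^ n / qpoch q n * (1 / euler_series q q))) =
      of_bool (n \<in> S) * q ^ n / qpoch q n * (1 / euler_series q q)" for n
    unfolding c sum_distrib_right sum_divide_distrib power_mult_distrib
    by (intro sum.cong refl) simp
  ultimately have "(\<lambda>n. of_bool (n \<in> S) * q ^ n / qpoch q n * (1 / euler_series q q)) sums
      (\<Sum>j<L. c j * (euler_series q (root_of_unity L j * q) * (1 / euler_series q q)))"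
    by simp
  moreover have "(\<lambda>n. of_bool (n \<in> S) * q ^ n / qpoch q n * (1 / euler_series q q)) sums F S q"
    using F_sums[OF q S] infsum_signed_weight_eq[OF q] by simp
  ultimately show ?thesis
    using sums_unique2 by fastforce
qed

text \<open>In the Fourier expansion the nontrivial characters die out at \<open>q = 1\<close>, and the trivial one
  contributes its coefficient, which is the density of \<open>S\<close>. There are finitely many characters, so
  a single Stolz angle serves all of them.\<close>
theorem F_periodic_tendsto_density:
  assumes L: "0 < L" and S: "0 \<notin> S" and per: "\<And>n. n mod L \<in> S \<longleftrightarrow> n \<in> S"
  shows "\<exists>M>1. (F S \<longlongrightarrow> of_real (real (card {m. m < L \<and> m \<in> S}) / real L)) (at 1 within stolz M)"
proof -
  define c where "c j = (\<Sum>m<L. of_bool (m \<in> S) / root_of_unity L m ^ j) / of_nat L" for j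
  have c: "of_bool (n \<in> S) = (\<Sum>j<L. c j * root_of_unity L j ^ n)" for n
    unfolding c_def using periodic_eq_sum_characters[OF L, of "\<lambda>n. of_bool (n \<in> S)" n] per by simp
  have c0: "c 0 = of_real (real (card {m. m < L \<and> m \<in> S}) / real L)"
    by (simp add: c_def Int_def)
  let ?R = "\<lambda>j q. euler_series q (root_of_unity L j * q) / euler_series q q"
  have nz: "euler_series q q \<noteq> 0" if "norm q < 1" for q
    using euler_series_eq_exp_qlog[OF that that] by simp
  have "eventually (\<lambda>M. (?R j \<longlongrightarrow> 0) (at 1 within stolz M)) (at_right 1)" if "j \<in> {1..<L}" for j
  proof (rule euler_series_ratio_tendsto_0)
    show "root_of_unity L j \<noteq> 1"
      using root_of_unity_eq_iff[OF L, of j 0] that by (auto simp:)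
  qed simp
  then have "eventually (\<lambda>M. \<forall>j\<in>{1..<L}. (?R j \<longlongrightarrow> 0) (at 1 within stolz M)) (at_right 1)"
    by (intro eventually_ball_finite) auto
  then have "eventually (\<lambda>M::real. 1 < M \<and> (\<forall>j\<in>{1..<L}. (?R j \<longlongrightarrow> 0) (at 1 within stolz M))) (at_right 1)"
    by (intro eventually_conj eventually_at_right_less)
  then obtain M :: real where M: "1 < M" "\<And>j. j \<in> {1..<L} \<Longrightarrow> (?R j \<longlongrightarrow> 0) (at 1 within stolz M)"
    using eventually_happens'[OF trivial_limit_at_right_real] by blast
  let ?F = "at 1 within stolz M"
  have disk: "eventually (\<lambda>q. norm q < 1) ?F"
    by (auto simp: eventually_at_filter stolz_def)
  have R: "(?R j \<longlongrightarrow> of_bool (j = 0)) ?F" if "j < L" for j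
  proof (cases "j = 0")
    case True
    have "eventually (\<lambda>q. 1 = ?R j q) ?F"
      using disk by eventually_elim (simp add: nz True)
    then have "(?R j \<longlongrightarrow> 1) ?F"
      by (rule Lim_transform_eventually[OF tendsto_const])
    with True show ?thesis by (simp only: simp_thms of_bool_eq)
  qed (use M that in auto)
  have "((\<lambda>q. \<Sum>j<L. c j * ?R j q) \<longlongrightarrow> (\<Sum>j<L. c j * of_bool (j = 0))) ?F"
    by (intro tendsto_sum tendsto_mult tendsto_const R) simp
  also have "(\<Sum>j<L. c j * of_bool (j = 0)) = c 0"
    using L by (simp add: of_bool_def if_distrib cong: if_cong)
  finally have "((\<lambda>q. \<Sum>j<L. c j * ?R j q) \<longlongrightarrow> c 0) ?F" .
  moreover have "eventually (\<lambda>q. (\<Sum>j<L. c j * ?R j q) = F S q) ?F"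
    using disk by eventually_elim (rule F_eq_sum_characters[OF _ S c, symmetric])
  ultimately have "(F S \<longlongrightarrow> c 0) ?F"
    by (rule Lim_transform_eventually)
  with M(1) c0 show ?thesis by auto
qed

section \<open>The density of the integers free of k-th powers of small primes\<close>

text \<open>The extra modulus \<open>D\<close> makes the induction on \<open>P\<close> work: among the multiples of \<open>D\<close>, those that are
  also divisible by a further \<open>d x\<close> are the multiples of \<open>D * d x\<close>, so avoiding \<open>d x\<close> removes a
  set of the same form.\<close>
lemma card_multiples_avoiding:
  fixes d :: "'a \<Rightarrow> nat"
  assumes "finite P" and "\<And>x y. x \<in> P \<Longrightarrow> y \<in> P \<Longrightarrow> x \<noteq> y \<Longrightarrow> coprime (d x) (d y)"
    and "\<And>x. x \<in> P \<Longrightarrow> coprime D (d x)" and "D * prod d P dvd L" and L: "0 < L"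
  shows "real (card {m. m < L \<and> D dvd m \<and> (\<forall>x\<in>P. \<not> d x dvd m)}) =
    real L / real D * (\<Prod>x\<in>P. 1 - 1 / real (d x))"
  using assms(1-4)
proof (induction P arbitrary: D rule: finite_induct)
  case empty
  then obtain t where t: "L = D * t" by auto
  with L have D: "0 < D" by auto
  have "{m. m < L \<and> D dvd m} = (*) D ` {..<t}"
    using D by (auto simp: t elim!: dvdE)
  then have "card {m. m < L \<and> D dvd m} = t"
    using D by (simp add: card_image inj_on_def)
  with D show ?case by (simp add: t)
next
  case (insert x P)
  let ?A = "\<lambda>D. {m. m < L \<and> D dvd m \<and> (\<forall>x\<in>P. \<not> d x dvd m)}"
  have dvd: "D * d x * prod d P dvd L" using insert by (simp add: mult.assoc)
  then have pos: "0 < D" "0 < d x" using L by (auto intro!: gr0I)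
  have "D * prod d P dvd D * d x * prod d P" by (simp add: mult_ac)
  then have IH1: "real (card (?A D)) = real L / real D * (\<Prod>x\<in>P. 1 - 1 / real (d x))"
    using insert dvd by (intro insert.IH) (auto dest: dvd_trans)
  have IH2: "real (card (?A (D * d x))) = real L / real (D * d x) * (\<Prod>x\<in>P. 1 - 1 / real (d x))"
  proof (rule insert.IH)
    fix y assume y: "y \<in> P"
    then have "x \<noteq> y" using insert.hyps by auto
    then show "coprime (D * d x) (d y)"
      using y insert.prems by (simp add: coprime_mult_left_iff)
  qed (use insert.prems dvd in auto)
  have "D * d x dvd m \<longleftrightarrow> D dvd m \<and> d x dvd m" for m
    using insert.prems(2)[of x] by (auto intro: divides_mult dvd_mult_left dvd_mult_right)
  then have "{m. m < L \<and> D dvd m \<and> (\<forall>x\<in>insert x P. \<not> d x dvd m)} = ?A D - ?A (D * d x)"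
    by auto
  moreover have "?A (D * d x) \<subseteq> ?A D" by (auto intro: dvd_mult_left)
  ultimately have "real (card {m. m < L \<and> D dvd m \<and> (\<forall>x\<in>insert x P. \<not> d x dvd m)}) =
      real (card (?A D)) - real (card (?A (D * d x)))"
    by (simp add: card_Diff_subset of_nat_diff card_mono)
  also have "\<dots> = real L / real D * (\<Prod>x\<in>insert x P. 1 - 1 / real (d x))"
    unfolding IH1 IH2 using insert.hyps pos by (simp add: field_simps)
  finally show ?case .
qed

theorem theorem1p4:
  fixes k N :: nat
  assumes "k \<ge> 2" and "N \<ge> 2"
  shows "\<exists>M>1. (F (S_fr k N) \<longlongrightarrow>
           (\<Prod>p\<in>{p. prime p \<and> p \<le> N}. 1 - 1 / of_nat p ^ k)) (at 1 within stolz M)"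
proof -
  define P where "P = {p. prime p \<and> p \<le> N}"
  define L where "L = (\<Prod>p\<in>P. p ^ k)"
  have fin: "finite P" by (auto simp: P_def)
  have L: "0 < L" by (auto simp: L_def P_def prime_gt_0_nat intro!: prod_pos)
  have dvd_L: "p ^ k dvd L" if "p \<in> P" for p
    unfolding L_def by (rule dvd_prodI[OF fin that])
  \<comment> \<open>The condition \<open>1 \<le> n\<close> is absorbed because \<open>2 \<le> N\<close> and \<open>2 ^ k\<close> divides \<open>0\<close>; this makes membership
    periodic.\<close>
  have S: "n \<in> S_fr k N \<longleftrightarrow> (\<forall>p\<in>P. \<not> p ^ k dvd n)" for n
  proof (cases "n = 0")
    case True
    have "2 \<in> P" using assms by (auto simp: P_def)
    then show ?thesis using True by (auto simp: S_fr_def)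
  qed (auto simp: S_fr_def P_def)
  have "\<exists>M>1. (F (S_fr k N) \<longlongrightarrow>
      of_real (real (card {m. m < L \<and> m \<in> S_fr k N}) / real L)) (at 1 within stolz M)"
  proof (rule F_periodic_tendsto_density[OF L])
    show "0 \<notin> S_fr k N" by (simp add: S_fr_def)
    show "n mod L \<in> S_fr k N \<longleftrightarrow> n \<in> S_fr k N" for n
      unfolding S using dvd_L by (simp add: dvd_mod_iff)
  qed
  moreover have "real (card {m. m < L \<and> m \<in> S_fr k N}) / real L = (\<Prod>p\<in>P. 1 - 1 / real p ^ k)"
  proof -
    have "real (card {m. m < L \<and> 1 dvd m \<and> (\<forall>p\<in>P. \<not> p ^ k dvd m)}) =
        real L / real 1 * (\<Prod>p\<in>P. 1 - 1 / real (p ^ k))"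
      by (rule card_multiples_avoiding[OF fin _ _ _ L])
        (auto simp: L_def P_def primes_coprime)
    then show ?thesis using L by (simp add: S)
  qed
  ultimately show ?thesis
    by (simp add: P_def)
qed

end
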